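(* Let $G=(V,E,I,\varsigma,\omega,\sigma)$ be an oriented hypergraph, and let $N$ be a non-edge-monic tail-equivalence class, or a non-edge-monic head-equivalence class, of contributors of $G$. Then $$\sum_{c\in N}\operatorname{csgn}(c)=0 .$$
   Context: An oriented hypergraph is a sextuple $G=(V,E,I,\varsigma,\omega,\sigma)$ with finite sets $V$ (vertices), $E$ (edges), $I$ (incidences) and functions $\varsigma:I\to V$ (port), $\omega:I\to E$ (attachment), $\sigma:I\to\{+1,-1\}$ (incidence signs). Several incidences may have the same port and attachment. A contributor $c$ of $G$ assigns to every $v\in V$ a step $(v,i_v,e_v,j_v,\pi(v))$, where $i_v,j_v\in I$ (possibly equal), $\omega(i_v)=\omega(j_v)=e_v\in E$, $\varsigma(i_v)=v$, $\varsigma(j_v)=\pi(v)$, such that $\pi=\pi_c:V\to V$ is a permutation. (Equivalently, $c$ is an incidence-preserving map $\bigsqcup_{v\in V}\overrightarrow{P}_1\to G$ of directed paths of length one with tails $t_v$ and heads $h_v$ such that $c(t_v)=v$ and $\{c(h_v)\mid v\in V\}=V$.) The incidence $i_v$ is the tail-incidence and $j_v$ the head-incidence of the step. The step at $v$ is a backstep if $i_v=j_v$; otherwise it is an adjacency (a loop if moreover $\pi(v)=v$). Contributor sign: $\operatorname{csgn}(c)=(-1)^{ec(c)+nc(c)+bs(c)}$, where $ec(c)$ is the number of cycles of even length of the permutation $\pi_c$; $bs(c)$ is the number of backsteps of $c$; and $nc(c)$ is the number of negative components, where a component is a cycle of $\pi_c$ whose steps are not a backstep (loops are included as components of length 1),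 and a component consisting of the steps at $v_1,\dots,v_k$ is negative if $(-1)^k\prod_{l=1}^{k}\sigma(i_{v_l})\sigma(j_{v_l})=-1$. Backsteps are not counted in $nc$. Two contributors are tail-equivalent if the images of their tail-incidences are the same, i.e. the sets $\{i_v\mid v\in V\}$ coincide (equivalently, they have the same $i_v$ for every $v$). They are head-equivalent if the images of their head-incidences are the same, i.e. the sets $\{j_v\mid v\in V\}$ coincide (equivalently, at each vertex $w$ the head-incidence with port $w$ is the same). A contributor is edge-monic if $e_v\ne e_w$ for all distinct $v,w\in V$. A tail-equivalence (head-equivalence) class is edge-monic if every contributor in it is edge-monic, and non-edge-monic otherwise. *)

theory Defs
  imports "HOL-Combinatorics.Orbits"
begin

record ('v, 'e, 'i) hypergraph_data =
  verts :: "'v set"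
  edges :: "'e set"
  incs  :: "'i set"
  port  :: "'i \<Rightarrow> 'v"
  att   :: "'i \<Rightarrow> 'e"
  isgn  :: "'i \<Rightarrow> int"

definition oriented_hypergraph :: "('v, 'e, 'i) hypergraph_data \<Rightarrow> bool" where
  "oriented_hypergraph G \<longleftrightarrow>
     finite (verts G) \<and> finite (edges G) \<and> finite (incs G) \<and>
     port G \<in> incs G \<rightarrow> verts G \<and>
     att G \<in> incs G \<rightarrow> edges G \<and>
     isgn G \<in> incs G \<rightarrow> {1, -1}"

datatype ('v, 'e, 'i) step =
  Step (tail_vertex: 'v) (tail_inc: 'i) (step_edge: 'e) (head_inc: 'i) (head_vertex: 'v)

definition is_step :: "('v, 'e, 'i) hypergraph_data \<Rightarrow> ('v, 'e, 'i) step \<Rightarrow> bool" where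
  "is_step G s \<longleftrightarrow>
     tail_inc s \<in> incs G \<and> head_inc s \<in> incs G \<and> step_edge s \<in> edges G \<and>
     att G (tail_inc s) = step_edge s \<and> att G (head_inc s) = step_edge s \<and>
     port G (tail_inc s) = tail_vertex s \<and> port G (head_inc s) = head_vertex s"

definition is_backstep :: "('v, 'e, 'i) step \<Rightarrow> bool" where
  "is_backstep s \<longleftrightarrow> tail_inc s = head_inc s"

text \<open>The permutation of a contributor, extended by the identity outside the vertex set.\<close>

definition contr_perm ::
  "('v, 'e, 'i) hypergraph_data \<Rightarrow> ('v \<Rightarrow> ('v, 'e, 'i) step) \<Rightarrow> 'v \<Rightarrow> 'v" where
  "contr_perm G c = perm_restrict (\<lambda>v. head_vertex (c v)) (verts G)"

text \<open>Contributors are extensional functions, so that each of them is counted exactly once.\<close>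

definition contributors ::
  "('v, 'e, 'i) hypergraph_data \<Rightarrow> ('v \<Rightarrow> ('v, 'e, 'i) step) set" where
  "contributors G =
     {c \<in> (\<Pi>\<^sub>E v\<in>verts G. {s. is_step G s \<and> tail_vertex s = v}).
        contr_perm G c permutes verts G}"

text \<open>The cycles of the permutation, each given by its set of vertices; fixed points are
  cycles of length 1.\<close>

definition contr_cycles ::
  "('v, 'e, 'i) hypergraph_data \<Rightarrow> ('v \<Rightarrow> ('v, 'e, 'i) step) \<Rightarrow> 'v set set" where
  "contr_cycles G c = orbit (contr_perm G c) ` verts G"

definition contr_components ::
  "('v, 'e, 'i) hypergraph_data \<Rightarrow> ('v \<Rightarrow> ('v, 'e, 'i) step) \<Rightarrow> 'v set set" where
  "contr_components G c = {C \<in> contr_cycles G c. \<forall>v\<in>C. \<not> is_backstep (c v)}"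

definition negative_component ::
  "('v, 'e, 'i) hypergraph_data \<Rightarrow> ('v \<Rightarrow> ('v, 'e, 'i) step) \<Rightarrow> 'v set \<Rightarrow> bool" where
  "negative_component G c C \<longleftrightarrow>
     (-1) ^ card C * (\<Prod>v\<in>C. isgn G (tail_inc (c v)) * isgn G (head_inc (c v))) = -1"

definition ec :: "('v, 'e, 'i) hypergraph_data \<Rightarrow> ('v \<Rightarrow> ('v, 'e, 'i) step) \<Rightarrow> nat" where
  "ec G c = card {C \<in> contr_cycles G c. even (card C)}"

definition nc :: "('v, 'e, 'i) hypergraph_data \<Rightarrow> ('v \<Rightarrow> ('v, 'e, 'i) step) \<Rightarrow> nat" where
  "nc G c = card {C \<in> contr_components G c. negative_component G c C}"

definition bs :: "('v, 'e, 'i) hypergraph_data \<Rightarrow> ('v \<Rightarrow> ('v, 'e, 'i) step) \<Rightarrow> nat" where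
  "bs G c = card {v \<in> verts G. is_backstep (c v)}"

definition csgn :: "('v, 'e, 'i) hypergraph_data \<Rightarrow> ('v \<Rightarrow> ('v, 'e, 'i) step) \<Rightarrow> int" where
  "csgn G c = (-1) ^ (ec G c + nc G c + bs G c)"

definition tail_equiv ::
  "('v, 'e, 'i) hypergraph_data \<Rightarrow> ('v \<Rightarrow> ('v, 'e, 'i) step) rel" where
  "tail_equiv G = {(c, d). c \<in> contributors G \<and> d \<in> contributors G \<and>
     (\<lambda>v. tail_inc (c v)) ` verts G = (\<lambda>v. tail_inc (d v)) ` verts G}"

definition head_equiv ::
  "('v, 'e, 'i) hypergraph_data \<Rightarrow> ('v \<Rightarrow> ('v, 'e, 'i) step) rel" where
  "head_equiv G = {(c, d). c \<in> contributors G \<and> d \<in> contributors G \<and>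
     (\<lambda>v. head_inc (c v)) ` verts G = (\<lambda>v. head_inc (d v)) ` verts G}"

definition edge_monic ::
  "('v, 'e, 'i) hypergraph_data \<Rightarrow> ('v \<Rightarrow> ('v, 'e, 'i) step) \<Rightarrow> bool" where
  "edge_monic G c \<longleftrightarrow>
     (\<forall>v\<in>verts G. \<forall>w\<in>verts G. v \<noteq> w \<longrightarrow> step_edge (c v) \<noteq> step_edge (c w))"

definition edge_monic_class ::
  "('v, 'e, 'i) hypergraph_data \<Rightarrow> ('v \<Rightarrow> ('v, 'e, 'i) step) set \<Rightarrow> bool" where
  "edge_monic_class G N \<longleftrightarrow> (\<forall>c\<in>N. edge_monic G c)"

lemma equiv_tail_equiv: "equiv (contributors G) (tail_equiv G)"
  by (rule equivI) (auto simp: tail_equiv_def refl_on_def sym_def trans_def)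

lemma equiv_head_equiv: "equiv (contributors G) (head_equiv G)"
  by (rule equivI) (auto simp: head_equiv_def refl_on_def sym_def trans_def)

text \<open>There are finitely many contributors, so sums over classes of contributors are genuine
  finite sums.\<close>

lemma finite_contributors:
  assumes "oriented_hypergraph G"
  shows "finite (contributors G)"
proof -
  have fin: "finite (verts G)" "finite (incs G)"
    using assms by (auto simp: oriented_hypergraph_def)
  have "{s. is_step G s} \<subseteq>
      (\<lambda>(i, j). Step (port G i) i (att G i) j (port G j)) ` (incs G \<times> incs G)"
  proof
    fix s assume "s \<in> {s. is_step G s}"
    then show "s \<in> (\<lambda>(i, j). Step (port G i) i (att G i) j (port G j)) ` (incs G \<times> incs G)"
      by (intro image_eqI[where x = "(tail_inc s, head_inc s)"])
        (auto simp: is_step_def intro: step.expand)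
  qed
  then have steps: "finite {s. is_step G s}"
    using fin by (blast intro: finite_subset)
  have "finite (\<Pi>\<^sub>E v\<in>verts G. {s. is_step G s \<and> tail_vertex s = v})"
    using fin(1) by (rule finite_PiE) (auto intro: finite_subset[OF _ steps])
  then show ?thesis
    by (rule finite_subset[rotated]) (auto simp: contributors_def)
qed

end

theory Submission
  imports Defs "HOL-Combinatorics.Cycles"
begin

text \<open>
  Since a backstep has incidence sign product 1, it contributes the same factor \<open>-1\<close> to the
  contributor sign as a negative loop would. Hence \<open>csgn c\<close> is the sign of the permutation of
  \<open>c\<close> times the product over all vertices of minus the product of the two incidence signs.
  If two steps of \<open>c\<close> use the same edge, exchanging their heads therefore negates \<open>csgn c\<close>. The
  exchange keeps the tail-incidences, the edges and the set of head-incidences, so it stays in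
  the class, and as the exchanged pair is chosen from the edges alone, it is an involution.
  One non-edge-monic contributor makes all of its class non-edge-monic, because the incidences
  shared by the class already witness the repeated edge.
\<close>

section \<open>Auxiliary facts on products of signs\<close>

lemma power_card_filter_eq_prod:
  fixes a :: "'b::comm_monoid_mult"
  assumes "finite K"
  shows "a ^ card {x \<in> K. P x} = (\<Prod>x\<in>K. if P x then a else 1)"
  using assms by (simp flip: prod.inter_filter)

lemma prod_in_one_minus_one:
  fixes f :: "'a \<Rightarrow> int"
  assumes "\<And>x. x \<in> A \<Longrightarrow> f x \<in> {1, -1}"
  shows "prod f A \<in> {1, -1}"
  using assms
proof (induction A rule: infinite_finite_induct)
  case (insert x F)
  then have "f x \<in> {1, -1}" "prod f F \<in> {1, -1}"
    by blast+
  with insert.hyps show ?case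
    by auto
qed auto

section \<open>The sign of a permutation in terms of its orbits\<close>

text \<open>A cycle of length n is a composition of n - 1 transpositions. The exponent n + 1 has the
  same parity and avoids truncated subtraction; for the empty list, whose cycle is the identity, it
  would give the wrong sign.\<close>

lemma sign_cycle_of_list:
  assumes "distinct cs" "cs \<noteq> []"
  shows "sign (cycle_of_list cs) = (-1) ^ Suc (length cs)"
  using assms
proof (induction cs rule: cycle_of_list.induct)
  case (1 i j cs)
  have "sign (cycle_of_list (i # j # cs)) = sign (transpose i j \<circ> cycle_of_list (j # cs))"
    by (simp only: cycle_of_list.simps)
  also have "\<dots> = sign (transpose i j) * sign (cycle_of_list (j # cs))"
    by (intro sign_compose permutation_swap_id permutation_of_cycle)
  finally show ?case
    using 1 by (simp add: sign_swap_id del: cycle_of_list.simps)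
qed auto

lemma cyclic_on_cycle_of_list:
  assumes "distinct cs" "cs \<noteq> []"
  shows "cyclic_on (cycle_of_list cs) (set cs)"
proof -
  let ?f = "cycle_of_list cs"
  have "set cs \<subseteq> orbit ?f (hd cs)"
  proof
    fix x assume "x \<in> set cs"
    then obtain n where n: "n < length cs" "x = cs ! n"
      unfolding in_set_conv_nth by blast
    \<comment> \<open>The n-th power of the cycle rotates the list by n places, so iterating from
      the head reaches every entry.\<close>
    have "(?f ^^ n) (hd cs) = hd (map (?f ^^ n) cs)"
      using assms(2) by (rule hd_map[symmetric])
    also have "\<dots> = hd (rotate n cs)"
      using assms(1) by (simp only: cyclic_rotation)
    also have "\<dots> = x"
      using n assms(2) by (simp add: hd_rotate_conv_nth)
    finally show "x \<in> orbit ?f (hd cs)"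
      using funpow_in_orbit[OF permutation_self_in_orbit[OF permutation_of_cycle]] by metis
  qed
  moreover have "orbit ?f (hd cs) \<subseteq> set cs"
    using assms(2) by (simp add: permutes_orbit_subset[OF cycle_permutes])
  ultimately show ?thesis
    using assms(2) cyclic_on_singleI[OF hd_in_set] by blast
qed

lemma cycle_decomp_finite_permutes:
  assumes "cycle_decomp S p"
  shows "finite S \<and> p permutes S"
  using assms
proof induction
  case (comp I p cs)
  have "cycle_of_list cs permutes set cs \<union> I"
    by (rule permutes_subset[OF cycle_permutes]) simp
  moreover have "p permutes set cs \<union> I"
    using comp.IH by (blast intro: permutes_subset)
  ultimately show ?case
    using comp.IH permutes_compose by blast
qed (auto simp: permutes_id)

text \<open>By induction along a cycle decomposition: composing with a disjoint nonempty cycle adds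
  exactly one orbit, the set of its entries, and keeps the other orbits, while the sign is
  multiplicative.\<close>

lemma sign_eq_prod_orbits:
  assumes "p permutes S" "finite S"
  shows "sign p = (\<Prod>C\<in>orbit p ` S. (-1) ^ Suc (card C))"
proof -
  have "cycle_decomp S p"
    using assms by (rule cycle_decomposition)
  then show ?thesis
  proof induction
    case (comp I p cs)
    let ?q = "cycle_of_list cs"
    have I: "finite I" "p permutes I"
      using cycle_decomp_finite_permutes[OF comp.hyps(1)] by auto
    have p: "permutation p"
      using I by (auto simp: permutation_permutes)
    show ?case
    proof (cases "cs = []")
      case True
      then show ?thesis
        using comp.IH by simp
    next
      case False
      have "orbit (?q \<circ> p) x = set cs" if "x \<in> set cs" for x
        using I comp.hyps that False
        by (intro orbit_cyclic_eq3 permutes_comp_preserves_cyclic1[where A = "set cs" and B = I]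
            cyclic_on_cycle_of_list) auto
      then have cs_orbits: "orbit (?q \<circ> p) ` set cs = {set cs}"
        using False by (auto simp: image_constant_conv cong: image_cong)
      have I_orbit: "orbit (?q \<circ> p) x = orbit p x" if "x \<in> I" for x
        using I comp.hyps that permutes_orbit_subset[OF I(2) that]
        by (intro orbit_cyclic_eq3
            permutes_comp_preserves_cyclic2[where A = "set cs" and B = I]
            cycle_permutes cyclic_on_orbit permutation_self_in_orbit p) auto
      \<comment> \<open>The new orbit must not occur among the old ones, since the product runs over
        a set and would otherwise gain no factor.\<close>
      have "set cs \<noteq> orbit p x" if "x \<in> I" for x
        using comp.hyps that permutation_self_in_orbit[OF p, of x] by blast
      then have "set cs \<notin> orbit p ` I"
        by auto
      moreover have "orbit (?q \<circ> p) ` (set cs \<union> I) = insert (set cs) (orbit p ` I)"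
        using cs_orbits I_orbit by (simp add: image_Un cong: image_cong)
      ultimately have "(\<Prod>C\<in>orbit (?q \<circ> p) ` (set cs \<union> I). (-1) ^ Suc (card C)) = sign ?q * sign p"
        using I comp.hyps comp.IH False by (simp add: sign_cycle_of_list distinct_card)
      also have "\<dots> = sign (?q \<circ> p)"
        by (rule sign_compose[OF permutation_of_cycle p, symmetric])
      finally show ?thesis
        by (rule sym)
    qed
  qed simp
qed

text \<open>The orbits partition \<open>S\<close>, so a product over vertices can be regrouped cycle
  by cycle.\<close>

lemma prod_orbits:
  fixes h :: "'a \<Rightarrow> 'b::comm_monoid_mult"
  assumes "p permutes S" "finite S"
  shows "(\<Prod>x\<in>S. h x) = (\<Prod>C\<in>orbit p ` S. \<Prod>x\<in>C. h x)"
proof -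
  have p: "permutation p"
    using assms by (auto simp: permutation_permutes)
  have S: "S = \<Union> (orbit p ` S)"
    using permutation_self_in_orbit[OF p] permutes_orbit_subset[OF assms(1)] by blast
  have "A \<inter> B = {}" if "A \<in> orbit p ` S" "B \<in> orbit p ` S" "A \<noteq> B" for A B
    using that orbit_cyclic_eq3[OF cyclic_on_orbit'[OF p]] by blast
  moreover have "\<forall>A\<in>orbit p ` S. finite A"
    using permutation_self_in_orbit[OF p] by (auto intro: finite_orbit)
  ultimately show ?thesis
    by (subst S, subst prod.Union_disjoint) auto
qed

section \<open>The contributor sign as a product over vertices\<close>

lemma contributorsD:
  assumes "c \<in> contributors G" "v \<in> verts G"
  shows "is_step G (c v)" "tail_vertex (c v) = v" "head_vertex (c v) \<in> verts G"
    "contr_perm G c v = head_vertex (c v)"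
proof -
  show "is_step G (c v)" "tail_vertex (c v) = v"
    using assms by (auto simp: contributors_def PiE_iff)
  show eq: "contr_perm G c v = head_vertex (c v)"
    using assms by (simp add: contr_perm_def perm_restrict_def)
  have "contr_perm G c permutes verts G"
    using assms by (simp add: contributors_def)
  from permutes_in_image[OF this, of v] show "head_vertex (c v) \<in> verts G"
    using assms(2) eq by simp
qed

text \<open>Each of the three counts is turned into a product over the cycles. The even cycles alone
  give the sign of the permutation; negative components and backsteps are merged cycle by cycle into
  the remaining factor.\<close>

lemma csgn_eq:
  assumes G: "oriented_hypergraph G" and c: "c \<in> contributors G"
  shows "csgn G c = sign (contr_perm G c) *
    (\<Prod>v\<in>verts G. - (isgn G (tail_inc (c v)) * isgn G (head_inc (c v))))"
proof -
  define p where "p = contr_perm G c"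
  define K where "K = orbit p ` verts G"
  let ?s = "\<lambda>v. isgn G (tail_inc (c v)) * isgn G (head_inc (c v))"
  let ?b = "\<lambda>v. if is_backstep (c v) then -1 else (1::int)"
  let ?n = "\<lambda>C. (\<forall>v\<in>C. \<not> is_backstep (c v)) \<and> negative_component G c C"
  have fin: "finite (verts G)" "finite K"
    using G by (auto simp: oriented_hypergraph_def K_def)
  have p: "p permutes verts G"
    using c by (simp add: contributors_def p_def)
  have sgn: "isgn G i \<in> {1, -1}" if "i \<in> incs G" for i
    using G that by (auto simp: oriented_hypergraph_def)
  have s: "?s v \<in> {1, -1}" if "v \<in> verts G" for v
    using contributorsD(1)[OF c that] sgn[of "tail_inc (c v)"] sgn[of "head_inc (c v)"]
    by (auto simp: is_step_def)
  have "(-1) ^ ec G c = (\<Prod>C\<in>K. if even (card C) then -1 else (1::int))"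
    unfolding ec_def contr_cycles_def K_def p_def
    using fin by (intro power_card_filter_eq_prod) simp
  also have "\<dots> = (\<Prod>C\<in>K. (-1) ^ Suc (card C))"
    by (intro prod.cong) auto
  also have "\<dots> = sign p"
    using sign_eq_prod_orbits[OF p fin(1)] by (simp add: K_def)
  finally have ec: "(-1) ^ ec G c = sign p" .
  have "nc G c = card {C \<in> K. ?n C}"
    by (auto simp: nc_def contr_components_def contr_cycles_def K_def p_def
        intro: arg_cong[where f = card])
  then have nc: "(-1) ^ nc G c = (\<Prod>C\<in>K. if ?n C then -1 else (1::int))"
    by (simp only: power_card_filter_eq_prod[OF fin(2)])
  have bs: "(-1) ^ bs G c = (\<Prod>C\<in>K. \<Prod>v\<in>C. ?b v)"
    unfolding bs_def K_def
    by (simp only: power_card_filter_eq_prod[OF fin(1)] prod_orbits[OF p fin(1), of ?b])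
  have "(if ?n C then -1 else 1) * (\<Prod>v\<in>C. ?b v) = (\<Prod>v\<in>C. - ?s v)" if "C \<in> K" for C
  \<comment> \<open>Without backsteps, the right-hand side is 1 or -1, and it is -1 exactly for a
    negative component.\<close>
  proof (cases "\<forall>v\<in>C. \<not> is_backstep (c v)")
    case True
    have "C \<subseteq> verts G"
      using that permutes_orbit_subset[OF p] by (auto simp: K_def)
    then have "(\<Prod>v\<in>C. - ?s v) \<in> {1, -1}"
      using s by (intro prod_in_one_minus_one) force
    moreover have "(\<Prod>v\<in>C. - ?s v) = (-1) ^ card C * (\<Prod>v\<in>C. ?s v)"
      by (rule prod_uminus)
    ultimately show ?thesis
      using True by (auto simp: negative_component_def)
  next
    case False
    then obtain v where v: "v \<in> C" "is_backstep (c v)"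
      by auto
    then have vV: "v \<in> verts G"
      using that permutes_orbit_subset[OF p] by (auto simp: K_def)
    \<comment> \<open>Both incidences of a backstep coincide, hence so do their ports. Its cycle is
      thus the single vertex \<open>v\<close>, and both sides equal -1.\<close>
    have "p v = v"
      using contributorsD[OF c vV] v(2) by (auto simp: is_step_def is_backstep_def p_def)
    then have "orbit p v = {v}"
      by (simp add: orbit_eq_singleton_iff)
    moreover have "C = orbit p v"
      using that v(1) orbit_cyclic_eq3[OF cyclic_on_orbit[OF p fin(1)]]
      by (force simp: K_def)
    ultimately have "C = {v}"
      by simp
    moreover have "?s v = 1"
      using v(2) contributorsD(1)[OF c vV] sgn[of "tail_inc (c v)"]
      by (auto simp: is_backstep_def is_step_def)
    ultimately show ?thesis
      using v(2) by simp
  qed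
  then have "(-1) ^ nc G c * (-1) ^ bs G c = (\<Prod>C\<in>K. \<Prod>v\<in>C. - ?s v)"
    unfolding nc bs by (simp only: prod.distrib[symmetric] cong: prod.cong)
  also have "\<dots> = (\<Prod>v\<in>verts G. - ?s v)"
    unfolding K_def by (rule prod_orbits[OF p fin(1), symmetric])
  finally show ?thesis
    by (simp add: csgn_def power_add ec mult.assoc flip: p_def)
qed

section \<open>Exchanging the heads of two steps\<close>

text \<open>Only the head components are precomposed with the transposition; the edge stays with the
  tail. The result is therefore meaningful as a family of steps only if \<open>v\<close> and
  \<open>w\<close> use the same edge.\<close>

definition swap_heads ::
  "'v \<Rightarrow> 'v \<Rightarrow> ('v \<Rightarrow> ('v, 'e, 'i) step) \<Rightarrow> 'v \<Rightarrow> ('v, 'e, 'i) step" where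
  "swap_heads v w c u =
     Step (tail_vertex (c u)) (tail_inc (c u)) (step_edge (c u))
       (head_inc (c (transpose v w u))) (head_vertex (c (transpose v w u)))"

lemma swap_heads_sel [simp]:
  "tail_vertex (swap_heads v w c u) = tail_vertex (c u)"
  "tail_inc (swap_heads v w c u) = tail_inc (c u)"
  "step_edge (swap_heads v w c u) = step_edge (c u)"
  "head_inc (swap_heads v w c u) = head_inc (c (transpose v w u))"
  "head_vertex (swap_heads v w c u) = head_vertex (c (transpose v w u))"
  by (simp_all add: swap_heads_def)

lemma swap_heads_swap_heads [simp]: "swap_heads v w (swap_heads v w c) = c"
  by (rule ext, rule step.expand) simp

lemma head_inc_image_swap_heads:
  assumes "v \<in> V" "w \<in> V"
  shows "(\<lambda>u. head_inc (swap_heads v w c u)) ` V = (\<lambda>u. head_inc (c u)) ` V"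
proof -
  have "transpose v w ` V = V"
    using assms by (intro permutes_image permutes_swap_id)
  then show ?thesis
    by (metis (no_types, lifting) image_cong image_image swap_heads_sel(4))
qed

lemma contr_perm_swap_heads:
  assumes "v \<in> verts G" "w \<in> verts G"
  shows "contr_perm G (swap_heads v w c) = contr_perm G c \<circ> transpose v w"
proof
  fix u
  have "transpose v w u \<in> verts G \<longleftrightarrow> u \<in> verts G"
    using assms by (intro permutes_in_image permutes_swap_id)
  moreover have "transpose v w u = u" if "u \<notin> verts G"
    using assms that by (metis transpose_apply_other)
  ultimately show "contr_perm G (swap_heads v w c) u = (contr_perm G c \<circ> transpose v w) u"
    by (simp add: contr_perm_def perm_restrict_def)
qed

lemma swap_heads_in_contributors:
  assumes c: "c \<in> contributors G" and vw: "v \<in> verts G" "w \<in> verts G"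
    and e: "step_edge (c v) = step_edge (c w)"
  shows "swap_heads v w c \<in> contributors G"
proof -
  have "is_step G (swap_heads v w c u) \<and> tail_vertex (swap_heads v w c u) = u"
    if u: "u \<in> verts G" for u
  proof -
    have "transpose v w u \<in> verts G"
      using u permutes_in_image[OF permutes_swap_id[OF vw]] by blast
    moreover have "step_edge (c (transpose v w u)) = step_edge (c u)"
      using e by (simp add: transpose_def)
    ultimately show ?thesis
      using contributorsD(1,2)[OF c u] contributorsD(1)[OF c] by (simp add: is_step_def)
  qed
  moreover have "swap_heads v w c u = undefined" if u: "u \<notin> verts G" for u
  proof -
    \<comment> \<open>Outside the vertex set the swap merely rebuilds \<open>c u\<close>, so
      extensionality is preserved.\<close>
    have "transpose v w u = u"
      using u vw by (metis transpose_apply_other)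
    then have "swap_heads v w c u = c u"
      by (intro step.expand) simp
    also have "\<dots> = undefined"
      using c u by (auto simp: contributors_def PiE_iff extensional_def)
    finally show ?thesis .
  qed
  moreover have "contr_perm G (swap_heads v w c) permutes verts G"
    using c vw by (auto simp: contr_perm_swap_heads contributors_def
        intro: permutes_compose permutes_swap_id)
  ultimately show ?thesis
    by (auto simp: contributors_def PiE_iff extensional_def)
qed

text \<open>In the product formula, the permutation gains one transposition, the tail signs stay,
  and the head signs are only reordered.\<close>

lemma csgn_swap_heads:
  assumes G: "oriented_hypergraph G" and c: "c \<in> contributors G"
    and vw: "v \<in> verts G" "w \<in> verts G" "v \<noteq> w"
    and e: "step_edge (c v) = step_edge (c w)"
  shows "csgn G (swap_heads v w c) = - csgn G c"
proof -
  have "finite (verts G)" "contr_perm G c permutes verts G"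
    using G c by (auto simp: oriented_hypergraph_def contributors_def)
  then have "permutation (contr_perm G c)"
    by (auto simp: permutation_permutes)
  then have "sign (contr_perm G (swap_heads v w c)) = - sign (contr_perm G c)"
    using vw by (simp add: contr_perm_swap_heads sign_compose permutation_swap_id sign_swap_id)
  moreover have "(\<Prod>u\<in>verts G. isgn G (head_inc (c (transpose v w u)))) =
      (\<Prod>u\<in>verts G. isgn G (head_inc (c u)))"
    using prod.permute[OF permutes_swap_id[OF vw(1,2)], of "\<lambda>u. isgn G (head_inc (c u))"]
    by (simp add: o_def)
  ultimately show ?thesis
    using csgn_eq[OF G c] csgn_eq[OF G swap_heads_in_contributors[OF c vw(1,2) e]]
    by (simp add: prod_uminus prod.distrib)
qed

text \<open>A sign-reversing involution on \<open>N\<close> makes the integer sum equal to its own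
  negative. The closure hypothesis covers tail and head classes alike.\<close>

lemma sum_csgn_eq_0:
  fixes N :: "('v \<Rightarrow> ('v, 'e, 'i) step) set"
  assumes G: "oriented_hypergraph G" and N: "N \<subseteq> contributors G"
    and non_monic: "\<And>c. c \<in> N \<Longrightarrow> \<not> edge_monic G c"
    and closed: "\<And>c v w. \<lbrakk>c \<in> N; v \<in> verts G; w \<in> verts G; step_edge (c v) = step_edge (c w)\<rbrakk>
      \<Longrightarrow> swap_heads v w c \<in> N"
  shows "(\<Sum>c\<in>N. csgn G c) = 0"
proof -
  \<comment> \<open>The choice depends on the edge map alone, which swapping heads preserves. So
    \<open>c\<close> and its image get the same pair, and flipping twice returns
    \<open>c\<close>.\<close>
  define pick :: "('v \<Rightarrow> 'e) \<Rightarrow> 'v \<times> 'v" where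
    "pick = (\<lambda>e. SOME (v, w). v \<in> verts G \<and> w \<in> verts G \<and> v \<noteq> w \<and> e v = e w)"
  define flip where
    "flip = (\<lambda>c :: 'v \<Rightarrow> ('v, 'e, 'i) step.
      case pick (\<lambda>u. step_edge (c u)) of (v, w) \<Rightarrow> swap_heads v w c)"
  have flip: "flip c \<in> N \<and> flip (flip c) = c \<and> csgn G (flip c) = - csgn G c" if "c \<in> N" for c
  proof -
    obtain v w where vw: "pick (\<lambda>u. step_edge (c u)) = (v, w)"
      by fastforce
    have "\<exists>p. case p of (v, w) \<Rightarrow>
        v \<in> verts G \<and> w \<in> verts G \<and> v \<noteq> w \<and> step_edge (c v) = step_edge (c w)"
      using non_monic[OF that] by (auto simp: edge_monic_def)
    from someI_ex[OF this]
    have "v \<in> verts G" "w \<in> verts G" "v \<noteq> w" "step_edge (c v) = step_edge (c w)"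
      using vw by (simp_all add: pick_def)
    then show ?thesis
      using that N by (auto simp: flip_def vw intro: closed csgn_swap_heads[OF G])
  qed
  have "(\<Sum>c\<in>N. csgn G c) = (\<Sum>c\<in>N. - csgn G c)"
    by (rule sum.reindex_bij_witness[where i = flip and j = flip]) (auto simp: flip)
  then show ?thesis
    by (simp add: sum_negf)
qed

section \<open>Equivalence classes\<close>

text \<open>The port recovers the vertex from its tail-incidence, so being edge-monic depends only
  on the set of tail-incidences, hence only on the class.\<close>

lemma edge_monic_iff_inj_on_tails:
  assumes "c \<in> contributors G"
  shows "edge_monic G c \<longleftrightarrow> inj_on (att G) ((\<lambda>v. tail_inc (c v)) ` verts G)"
proof -
  have "port G (tail_inc (c v)) = v" if "v \<in> verts G" for v
    using contributorsD(1,2)[OF assms that] by (simp add: is_step_def)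
  then have "inj_on (\<lambda>v. tail_inc (c v)) (verts G)"
    by (rule inj_on_inverseI)
  then have "inj_on (att G) ((\<lambda>v. tail_inc (c v)) ` verts G) \<longleftrightarrow>
      inj_on (\<lambda>v. att G (tail_inc (c v))) (verts G)"
    using comp_inj_on_iff[of "\<lambda>v. tail_inc (c v)" "verts G" "att G"] by (simp add: o_def)
  also have "\<dots> \<longleftrightarrow> inj_on (\<lambda>v. step_edge (c v)) (verts G)"
    using contributorsD(1)[OF assms] by (intro inj_on_cong) (auto simp: is_step_def)
  finally show ?thesis
    by (auto simp: edge_monic_def inj_on_def)
qed

lemma edge_monic_iff_inj_on_heads:
  assumes "c \<in> contributors G"
  shows "edge_monic G c \<longleftrightarrow> inj_on (att G) ((\<lambda>v. head_inc (c v)) ` verts G)"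
proof -
  \<comment> \<open>The port of a head-incidence is the image of its vertex under the permutation,
    so injectivity of the permutation takes over the role of recovering the vertex.\<close>
  have "inj (contr_perm G c)"
    using assms permutes_inj by (auto simp: contributors_def)
  moreover have "port G (head_inc (c v)) = contr_perm G c v" if "v \<in> verts G" for v
    using contributorsD(1,4)[OF assms that] by (simp add: is_step_def)
  ultimately have "inj_on (\<lambda>v. head_inc (c v)) (verts G)"
    by (intro inj_onI) (metis injD)
  then have "inj_on (att G) ((\<lambda>v. head_inc (c v)) ` verts G) \<longleftrightarrow>
      inj_on (\<lambda>v. att G (head_inc (c v))) (verts G)"
    using comp_inj_on_iff[of "\<lambda>v. head_inc (c v)" "verts G" "att G"] by (simp add: o_def)
  also have "\<dots> \<longleftrightarrow> inj_on (\<lambda>v. step_edge (c v)) (verts G)"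
    using contributorsD(1)[OF assms] by (intro inj_on_cong) (auto simp: is_step_def)
  finally show ?thesis
    by (auto simp: edge_monic_def inj_on_def)
qed

theorem theorem2p2p3:
  fixes G :: "('v, 'e, 'i) hypergraph_data"
    and N :: "('v \<Rightarrow> ('v, 'e, 'i) step) set"
  assumes "oriented_hypergraph G"
    and "N \<in> contributors G // tail_equiv G \<or> N \<in> contributors G // head_equiv G"
    and "\<not> edge_monic_class G N"
  shows "(\<Sum>c\<in>N. csgn G c) = 0"
proof -
  obtain d where d: "d \<in> N" "\<not> edge_monic G d"
    using assms(3) by (auto simp: edge_monic_class_def)
  from assms(2) show ?thesis
  proof
    assume "N \<in> contributors G // tail_equiv G"
    then obtain a where "a \<in> contributors G" "N = tail_equiv G `` {a}"
      by (rule quotientE)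
    then have N: "N = {c \<in> contributors G.
        (\<lambda>v. tail_inc (a v)) ` verts G = (\<lambda>v. tail_inc (c v)) ` verts G}"
      by (auto simp: tail_equiv_def)
    show ?thesis
      using assms(1)
    proof (rule sum_csgn_eq_0)
      show "\<not> edge_monic G c" if "c \<in> N" for c
        using that d by (auto simp: N edge_monic_iff_inj_on_tails)
    qed (auto simp: N swap_heads_in_contributors)
  next
    assume "N \<in> contributors G // head_equiv G"
    then obtain a where "a \<in> contributors G" "N = head_equiv G `` {a}"
      by (rule quotientE)
    then have N: "N = {c \<in> contributors G.
        (\<lambda>v. head_inc (a v)) ` verts G = (\<lambda>v. head_inc (c v)) ` verts G}"
      by (auto simp: head_equiv_def)
    show ?thesis
      using assms(1)
    proof (rule sum_csgn_eq_0)
      show "\<not> edge_monic G c" if "c \<in> N" for c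
        using that d by (auto simp: N edge_monic_iff_inj_on_heads)
    \<comment> \<open>Unfolding the swapped head-incidence would keep the image lemma from
      matching.\<close>
    qed (auto simp: N swap_heads_in_contributors head_inc_image_swap_heads
        simp del: swap_heads_sel(4))
  qed
qed

end
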